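(* Let $X$ be a real Banach space, let $\varphi: X\to[0,\infty)$ be a function, let $f: X\to(-\infty,\infty]$ have $\mathrm{dom}\,f\neq\emptyset$, and suppose that $(f\oplus\varphi)(x)>-\infty$ for all $x\in X$. Let $\varepsilon\ge0$. Suppose that $\varphi$ is subadditive and positively homogeneous. Let $\bar x\in X$ satisfy $\mathcal P(\bar x)\neq\emptyset$. Then $$\widehat\partial_\varepsilon(f\oplus\varphi)(\bar x)\subset\bigcap_{w\in\mathcal P(\bar x)}\ \bigcap_{t\in(0,1]}\Big(\widehat\partial_\varepsilon(f\oplus\varphi)\big(tw+(1-t)\bar x\big)\cap\big[-\widehat\partial_\varepsilon\varphi(w-\bar x)\big]\Big).$$
   Context: $X^*$ is the dual of $X$ with pairing $\langle\cdot,\cdot\rangle$. $\mathrm{dom}\,f:=\{x\in X: f(x)<\infty\}$. The infimal convolution is $(f\oplus\varphi)(x):=\inf\{f(w)+\varphi(w-x): w\in X\}$ (note the argument $w-x$); under the standing assumptions it is real-valued. The projection at $x$ is $\mathcal P(x):=\{w\in X: f(w)+\varphi(w-x)=(f\oplus\varphi)(x)\}$. $\varphi$ is subadditive if $\varphi(x+y)\le\varphi(x)+\varphi(y)$ for all $x,y\in X$; positively homogeneous if $\varphi(tx)=t\varphi(x)$ for all $t>0$, $x\in X$. For $g:X\to(-\infty,\infty]$, $\varepsilon\ge0$ and $\bar x\in\mathrm{dom}\,g$, the $\varepsilon$-Fréchet subdifferential is $$\widehat\partial_\varepsilon g(\bar x):=\Big\{x^*\in X^*: \liminf_{x\to\bar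 x}\frac{g(x)-g(\bar x)-\langle x^*,x-\bar x\rangle}{\|x-\bar x\|}\ge-\varepsilon\Big\}.$$ For $A\subset X^*$, $-A:=\{-x^*:x^*\in A\}$. *)

theory Defs
  imports "HOL-Analysis.Analysis"
begin

text \<open>
  Functions with values in the half-open interval from minus infinity (excluded) to plus infinity
  (included) are modelled as \<^typ>\<open>ereal\<close>-valued functions together with the hypothesis that the
  value minus infinity is not attained. The dual of a space \<open>'a\<close> is the type
  \<open>'a \<Rightarrow>\<^sub>L real\<close> of bounded linear functionals.
\<close>

definition effective_domain :: "('a \<Rightarrow> ereal) \<Rightarrow> 'a set" where
  "effective_domain f = {x. f x < \<infinity>}"

text \<open>Note the argument \<open>w - x\<close> of \<open>\<phi>\<close>, rather than the more usual \<open>x - w\<close>.\<close>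

definition inf_conv :: "('a::real_normed_vector \<Rightarrow> ereal) \<Rightarrow> ('a \<Rightarrow> real) \<Rightarrow> 'a \<Rightarrow> ereal" where
  "inf_conv f \<phi> x = (INF w. f w + ereal (\<phi> (w - x)))"

definition inf_conv_proj :: "('a::real_normed_vector \<Rightarrow> ereal) \<Rightarrow> ('a \<Rightarrow> real) \<Rightarrow> 'a \<Rightarrow> 'a set" where
  "inf_conv_proj f \<phi> x = {w. f w + ereal (\<phi> (w - x)) = inf_conv f \<phi> x}"

definition subadditive_fun :: "('a::real_vector \<Rightarrow> real) \<Rightarrow> bool" where
  "subadditive_fun \<phi> \<longleftrightarrow> (\<forall>x y. \<phi> (x + y) \<le> \<phi> x + \<phi> y)"

definition pos_homogeneous :: "('a::real_vector \<Rightarrow> real) \<Rightarrow> bool" where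
  "pos_homogeneous \<phi> \<longleftrightarrow> (\<forall>t>0. \<forall>x. \<phi> (t *\<^sub>R x) = t * \<phi> x)"

text \<open>
  The subdifferential is only meaningful at points of the effective domain of \<open>g\<close>; elsewhere it
  is taken to be empty. The lower limit is over the punctured neighbourhoods of \<open>x0\<close>.
\<close>

definition frechet_subdiff ::
  "real \<Rightarrow> ('a::real_normed_vector \<Rightarrow> ereal) \<Rightarrow> 'a \<Rightarrow> ('a \<Rightarrow>\<^sub>L real) set" where
  "frechet_subdiff \<epsilon> g x0 =
    {xs. x0 \<in> effective_domain g \<and>
         Liminf (at x0)
           (\<lambda>x. (g x - g x0 - ereal (blinfun_apply xs (x - x0))) / ereal (norm (x - x0)))
         \<ge> ereal (- \<epsilon>)}"

end

theory Submission
  imports Defs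
begin

text \<open>
  Write \<open>F\<close> for the infimal convolution of \<open>f\<close> and \<open>\<phi>\<close>. Two inequalities carry the proof.
  Subadditivity makes \<open>F\<close> one-sidedly Lipschitz with modulus \<open>\<phi>\<close>, namely
  \<open>F x \<le> F y + \<phi> (y - x)\<close>, and every \<open>w\<close> gives the competitor bound
  \<open>F x \<le> f w + \<phi> (w - x)\<close>, with equality at \<open>xbar\<close> if \<open>w\<close> is a projection of \<open>xbar\<close>.

  On the segment from \<open>xbar\<close> to such a \<open>w\<close> the two bounds meet: at
  \<open>z = t w + (1 - t) xbar\<close> homogeneity turns them into
  \<open>F z = F xbar - t \<phi> (w - xbar)\<close>. Since translating by \<open>z - xbar\<close> lowers \<open>F\<close> by at most
  \<open>\<phi> (z - xbar) = t \<phi> (w - xbar)\<close> anywhere, and by exactly this amount at \<open>xbar\<close>, the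
  increments of \<open>F\<close> at \<open>z\<close> dominate those at \<open>xbar\<close>. The competitor bound at \<open>xbar - h\<close> shows
  likewise that the increment of \<open>\<phi>\<close> at \<open>w - xbar\<close> in direction \<open>h\<close> dominates that of \<open>F\<close> at
  \<open>xbar\<close> in direction \<open>- h\<close>. Subgradients pass to dominating increments
  (lemma \<open>frechet_subdiff_mono_increment\<close>), with a change of sign in the second case.
\<close>

text \<open>
  Clearing the denominator turns the lower limit of extended real quotients into a real inequality
  in which the direction \<open>h = 0\<close> is trivially admissible, so that increments at different base
  points and in reversed directions can be compared pointwise.
\<close>

lemma mem_frechet_subdiff_iff:
  fixes g :: "'a::real_normed_vector \<Rightarrow> real"
  shows "xs \<in> frechet_subdiff \<epsilon> (\<lambda>x. ereal (g x)) x \<longleftrightarrow>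
    (\<forall>e>\<epsilon>. \<exists>d>0. \<forall>h. norm h < d \<longrightarrow>
       g (x + h) - g x - blinfun_apply xs h \<ge> - e * norm h)"
    (is "?L \<longleftrightarrow> ?R")
proof -
  let ?q = "\<lambda>y. (g y - g x - blinfun_apply xs (y - x)) / norm (y - x)"
  have quot: "(ereal (g y) - ereal (g x) - ereal (blinfun_apply xs (y - x))) / ereal (norm (y - x))
      = ereal (?q y)" if "y \<noteq> x" for y
    using that by simp
  have "Liminf (at x) (\<lambda>y. (ereal (g y) - ereal (g x) - ereal (blinfun_apply xs (y - x)))
      / ereal (norm (y - x))) = Liminf (at x) (\<lambda>y. ereal (?q y))"
    by (rule Liminf_eq) (use quot in \<open>auto simp: eventually_at_filter\<close>)
  then have "?L \<longleftrightarrow> ereal (- \<epsilon>) \<le> Liminf (at x) (\<lambda>y. ereal (?q y))"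
    by (simp add: frechet_subdiff_def effective_domain_def)
  also have "\<dots> \<longleftrightarrow> (\<forall>e>\<epsilon>. eventually (\<lambda>y. - e < ?q y) (at x))"
  proof
    assume *: "ereal (- \<epsilon>) \<le> Liminf (at x) (\<lambda>y. ereal (?q y))"
    show "\<forall>e>\<epsilon>. eventually (\<lambda>y. - e < ?q y) (at x)"
    proof (intro allI impI)
      fix e assume "\<epsilon> < e"
      then have "ereal (- e) < ereal (- \<epsilon>)" by simp
      with * have "eventually (\<lambda>y. ereal (- e) < ereal (?q y)) (at x)"
        unfolding le_Liminf_iff by blast
      then show "eventually (\<lambda>y. - e < ?q y) (at x)" by simp
    qed
  next
    assume *: "\<forall>e>\<epsilon>. eventually (\<lambda>y. - e < ?q y) (at x)"
    show "ereal (- \<epsilon>) \<le> Liminf (at x) (\<lambda>y. ereal (?q y))"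
      unfolding le_Liminf_iff
    proof (intro allI impI)
      fix c assume c: "c < ereal (- \<epsilon>)"
      then obtain r where r: "c < ereal r" "ereal r < ereal (- \<epsilon>)"
        using ereal_dense2 by blast
      then have "eventually (\<lambda>y. r < ?q y) (at x)"
        using *[rule_format, of "- r"] by simp
      then show "eventually (\<lambda>y. c < ereal (?q y)) (at x)"
        by eventually_elim (use r(1) less_trans less_ereal.simps(1) in blast)
    qed
  qed
  also have "\<dots> \<longleftrightarrow> ?R"
  proof
    assume *: "\<forall>e>\<epsilon>. eventually (\<lambda>y. - e < ?q y) (at x)"
    show ?R
    proof (intro allI impI)
      fix e assume "\<epsilon> < e"
      with * obtain d where d: "d > 0" "\<And>y. y \<noteq> x \<Longrightarrow> dist y x < d \<Longrightarrow> - e < ?q y"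
        unfolding eventually_at by blast
      have "g (x + h) - g x - blinfun_apply xs h \<ge> - e * norm h" if "norm h < d" for h
      proof (cases "h = 0")
        case False
        then have "- e < (g (x + h) - g x - blinfun_apply xs h) / norm h"
          using d(2)[of "x + h"] that by (simp add: dist_norm)
        then show ?thesis using False by (simp add: pos_less_divide_eq)
      qed (simp add: blinfun.zero_right)
      with d(1) show "\<exists>d>0. \<forall>h. norm h < d \<longrightarrow>
          g (x + h) - g x - blinfun_apply xs h \<ge> - e * norm h" by blast
    qed
  next
    assume R: ?R
    show "\<forall>e>\<epsilon>. eventually (\<lambda>y. - e < ?q y) (at x)"
    proof (intro allI impI)
      fix e assume "\<epsilon> < e"
      \<comment> \<open>The midpoint of \<open>\<epsilon>\<close> and \<open>e\<close> leaves room to turn the weak inequality into a strict one.\<close>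
      define m where "m = (\<epsilon> + e) / 2"
      have m: "\<epsilon> < m" "m < e" using \<open>\<epsilon> < e\<close> by (auto simp: m_def)
      obtain d where d: "d > 0"
        "\<And>h. norm h < d \<Longrightarrow> g (x + h) - g x - blinfun_apply xs h \<ge> - m * norm h"
        using R m(1) by blast
      have "- e < ?q y" if "y \<noteq> x" "dist y x < d" for y
      proof -
        have "- m * norm (y - x) \<le> g y - g x - blinfun_apply xs (y - x)"
          using d(2)[of "y - x"] that by (simp add: dist_norm)
        then have "- m \<le> ?q y" using that by (subst pos_le_divide_eq) auto
        with m(2) show ?thesis by linarith
      qed
      with d(1) show "eventually (\<lambda>y. - e < ?q y) (at x)"
        unfolding eventually_at by blast
    qed
  qed
  finally show ?thesis .
qed

text \<open>
  Only the increments of a function at the base point enter its subdifferential, and these from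
  below. The sign \<open>s\<close> allows directions to be reversed, which does not change their norm.
\<close>

lemma frechet_subdiff_mono_increment:
  fixes g k :: "'a::real_normed_vector \<Rightarrow> real"
  assumes xs: "xs \<in> frechet_subdiff \<epsilon> (\<lambda>x. ereal (g x)) x"
    and s: "\<bar>s\<bar> = 1"
    and inc: "\<And>h. g (x + s *\<^sub>R h) - g x \<le> k (y + h) - k y"
  shows "s *\<^sub>R xs \<in> frechet_subdiff \<epsilon> (\<lambda>x. ereal (k x)) y"
  unfolding mem_frechet_subdiff_iff
proof (intro allI impI)
  fix e assume "\<epsilon> < e"
  then obtain d where d: "d > 0"
    "\<And>h. norm h < d \<Longrightarrow> g (x + h) - g x - blinfun_apply xs h \<ge> - e * norm h"
    using xs unfolding mem_frechet_subdiff_iff by blast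
  have "k (y + h) - k y - blinfun_apply (s *\<^sub>R xs) h \<ge> - e * norm h" if "norm h < d" for h
  proof -
    have "- e * norm h \<le> g (x + s *\<^sub>R h) - g x - s * blinfun_apply xs h"
      using d(2)[of "s *\<^sub>R h"] that s by (simp add: blinfun.scaleR_right)
    then show ?thesis using inc[of h] by (simp add: blinfun.scaleR_left)
  qed
  with d(1) show "\<exists>d>0. \<forall>h. norm h < d \<longrightarrow>
      k (y + h) - k y - blinfun_apply (s *\<^sub>R xs) h \<ge> - e * norm h" by blast
qed

lemma inf_conv_le: "inf_conv f \<phi> x \<le> f w + ereal (\<phi> (w - x))"
  unfolding inf_conv_def by (rule INF_lower) simp

text \<open>
  Each competitor \<open>w\<close> for the value at \<open>y\<close> also competes at \<open>x\<close>, at the extra cost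
  \<open>\<phi> (w - x) - \<phi> (w - y) \<le> \<phi> (y - x)\<close>.
\<close>

lemma inf_conv_le_shift:
  assumes "subadditive_fun \<phi>"
  shows "inf_conv f \<phi> x \<le> inf_conv f \<phi> y + ereal (\<phi> (y - x))"
proof -
  have "inf_conv f \<phi> x - ereal (\<phi> (y - x)) \<le> f w + ereal (\<phi> (w - y))" for w
  proof -
    have "\<phi> (w - x) \<le> \<phi> (w - y) + \<phi> (y - x)"
      using assms[unfolded subadditive_fun_def, rule_format, of "w - y" "y - x"] by simp
    then have "f w + ereal (\<phi> (w - x)) \<le> f w + ereal (\<phi> (w - y)) + ereal (\<phi> (y - x))"
      by (simp add: add.assoc add_left_mono)
    with inf_conv_le[of f \<phi> x w]
    have "inf_conv f \<phi> x \<le> f w + ereal (\<phi> (w - y)) + ereal (\<phi> (y - x))"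
      by (rule order_trans)
    then show ?thesis by (simp add: ereal_minus_le)
  qed
  then have "inf_conv f \<phi> x - ereal (\<phi> (y - x)) \<le> inf_conv f \<phi> y"
    unfolding inf_conv_def[of f \<phi> y] by (intro INF_greatest)
  then show ?thesis by (simp add: ereal_minus_le)
qed

lemma inf_conv_less_top:
  assumes "effective_domain f \<noteq> {}"
  shows "inf_conv f \<phi> x < \<infinity>"
proof -
  obtain w where "f w < \<infinity>" using assms by (auto simp: effective_domain_def)
  then have "f w + ereal (\<phi> (w - x)) < \<infinity>" by simp
  with inf_conv_le[of f \<phi> x w] show ?thesis by (rule le_less_trans)
qed

lemma pos_homogeneous_zero:
  assumes "pos_homogeneous \<phi>"
  shows "\<phi> 0 = 0"
  using assms[unfolded pos_homogeneous_def, rule_format, of 2 0] by simp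

lemma pos_homogeneous_scaleR:
  assumes "pos_homogeneous \<phi>" and "t \<ge> 0"
  shows "\<phi> (t *\<^sub>R x) = t * \<phi> x"
  using assms pos_homogeneous_zero[OF assms(1)]
  by (cases "t = 0") (auto simp: pos_homogeneous_def)

theorem theorem4p6:
  fixes f :: "'a::banach \<Rightarrow> ereal"
    and \<phi> :: "'a \<Rightarrow> real"
    and \<epsilon> :: real
    and xbar :: 'a
  assumes "\<And>x. \<phi> x \<ge> 0"
    and "\<And>x. f x > -\<infinity>"
    and "effective_domain f \<noteq> {}"
    and "\<And>x. inf_conv f \<phi> x > -\<infinity>"
    and "\<epsilon> \<ge> 0"
    and "subadditive_fun \<phi>"
    and "pos_homogeneous \<phi>"
    and "inf_conv_proj f \<phi> xbar \<noteq> {}"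
  shows "frechet_subdiff \<epsilon> (inf_conv f \<phi>) xbar \<subseteq>
    (\<Inter>w \<in> inf_conv_proj f \<phi> xbar. \<Inter>t \<in> {0<..1::real}.
       frechet_subdiff \<epsilon> (inf_conv f \<phi>) (t *\<^sub>R w + (1 - t) *\<^sub>R xbar)
       \<inter> uminus ` frechet_subdiff \<epsilon> (\<lambda>x. ereal (\<phi> x)) (w - xbar))"
proof (intro subsetI INT_I IntI)
  define G where "G x = real_of_ereal (inf_conv f \<phi> x)" for x
  have F: "inf_conv f \<phi> = (\<lambda>x. ereal (G x))"
  proof
    fix x
    have "\<bar>inf_conv f \<phi> x\<bar> \<noteq> \<infinity>"
      using assms(4)[of x] inf_conv_less_top[OF assms(3), of \<phi> x] by auto
    then show "inf_conv f \<phi> x = ereal (G x)" by (simp add: G_def ereal_real')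
  qed
  have shift: "G x \<le> G y + \<phi> (y - x)" for x y
    using inf_conv_le_shift[OF assms(6), of f x y] by (simp add: F)
  fix xs w and t :: real
  assume xs: "xs \<in> frechet_subdiff \<epsilon> (inf_conv f \<phi>) xbar"
    and w: "w \<in> inf_conv_proj f \<phi> xbar" and t: "t \<in> {0<..1}"
  have eq: "f w + ereal (\<phi> (w - xbar)) = ereal (G xbar)"
    using w by (simp add: inf_conv_proj_def F)
  obtain c where c: "f w = ereal c" using eq by (cases "f w") auto
  have G_xbar: "G xbar = c + \<phi> (w - xbar)" using eq c by simp
  have G_le: "G x \<le> c + \<phi> (w - x)" for x
    using inf_conv_le[of f \<phi> x w] by (simp add: F c)

  define z where "z = t *\<^sub>R w + (1 - t) *\<^sub>R xbar"
  have "z - xbar = t *\<^sub>R (w - xbar)" "w - z = (1 - t) *\<^sub>R (w - xbar)"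
    by (simp_all add: z_def algebra_simps)
  then have phi_z: "\<phi> (z - xbar) = t * \<phi> (w - xbar)" "\<phi> (w - z) = (1 - t) * \<phi> (w - xbar)"
    using t by (simp_all add: pos_homogeneous_scaleR[OF assms(7)])
  have G_z: "G z \<le> G xbar - \<phi> (z - xbar)"
    using G_le[of z] by (simp add: phi_z G_xbar algebra_simps)
  have "G (xbar + 1 *\<^sub>R h) - G xbar \<le> G (z + h) - G z" for h
    using shift[of "xbar + h" "z + h"] G_z by simp
  from frechet_subdiff_mono_increment[OF xs[unfolded F] _ this]
  show "xs \<in> frechet_subdiff \<epsilon> (inf_conv f \<phi>) (t *\<^sub>R w + (1 - t) *\<^sub>R xbar)"
    by (simp add: F z_def)

  have "G (xbar + (- 1) *\<^sub>R h) - G xbar \<le> \<phi> (w - xbar + h) - \<phi> (w - xbar)" for h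
    using G_le[of "xbar - h"] by (simp add: G_xbar algebra_simps)
  from frechet_subdiff_mono_increment[OF xs[unfolded F] _ this]
  have "- xs \<in> frechet_subdiff \<epsilon> (\<lambda>x. ereal (\<phi> x)) (w - xbar)" by simp
  then show "xs \<in> uminus ` frechet_subdiff \<epsilon> (\<lambda>x. ereal (\<phi> x)) (w - xbar)"
    by (rule rev_image_eqI) simp
qed

end
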